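(* Let $\Omega\subsetneq\mathbb C$ be a simply connected domain and $w',a,u\in\Omega$. Then $$\langle T(w)T(w')\rangle^+_\Omega=\frac14\cdot\frac1{(w-w')^4}+\frac{2\langle T(w')\rangle^+_\Omega}{(w-w')^2}+\frac{\partial_{w'}\langle T(w')\rangle^+_\Omega}{w-w'}+O(1)\quad\text{as }w\to w',$$ $$\langle T(w)\varepsilon(a)\rangle^+_\Omega=\frac12\cdot\frac{\langle\varepsilon(a)\rangle^+_\Omega}{(w-a)^2}+\frac{\partial_a\langle\varepsilon(a)\rangle^+_\Omega}{w-a}+O(1)\quad\text{as }w\to a,$$ $$\langle T(w)\sigma(u)\rangle^+_\Omega=\frac1{16}\cdot\frac{\langle\sigma(u)\rangle^+_\Omega}{(w-u)^2}+\frac{\partial_u\langle\sigma(u)\rangle^+_\Omega}{w-u}+O(1)\quad\text{as }w\to u.$$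
   Context: $\partial_a=\frac12(\partial_x-i\partial_y)$ is the Wirtinger derivative. Let $\phi$ be any conformal map from $\Omega$ onto the upper half-plane $\mathbb H$ and fix a branch of $(\phi')^{1/2}$ on $\Omega$. Put $$f_\Omega(a,z)=\frac{2(\phi'(a))^{1/2}(\phi'(z))^{1/2}}{\phi(z)-\phi(a)},\qquad f^\star_\Omega(a,z)=\frac{2\,\overline{(\phi'(a))^{1/2}}\,(\phi'(z))^{1/2}}{\phi(z)-\overline{\phi(a)}},\qquad f^\dagger_\Omega(a,z)=f_\Omega(a,z)-\frac2{z-a}$$ (independent of the choice of $\phi$). Define: - $\langle T(w)\rangle^+_\Omega=\frac14\partial_zf^\dagger_\Omega(w,z)|_{z=w}$, $\ \langle\varepsilon(a)\rangle^+_\Omega=\frac i2f^\star_\Omega(a,a)$, $\ \langle\sigma(u)\rangle^+_\Omega=(2|\phi'(u)|)^{1/8}(\mathrm{Im}\,\phi(u))^{-1/8}$; - $\langle T(w)T(w')\rangle^+_\Omega=\langle T(w)\rangle^+_\Omega\langle T(w')\rangle^+_\Omega+\frac1{16}\big(\partial_wf_\Omega(w,w')\partial_{w'}f_\Omega(w,w')-f_\Omega(w,w')\partial_w\partial_{w'}f_\Omega(w,w')\big)$; - $\langle T(w)\varepsilon(a)\rangle^+_\Omega=\langle T(w)\rangle^+_\Omega\langle\varepsilon(a)\rangle^+_\Omega+\frac i8\big(f_\Omega(a,w)\partial_wf^\star_\Omega(a,w)-f^\star_\Omega(a,w)\partial_wf_\Omega(a,w)\big)$; - for $u\in\mathbb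 H$ and $a,z\in\mathbb H\setminus\{u\}$ close to each other, $f_{[\mathbb H,u]}(a,z)=\Big[\frac{(a-u)(a-\bar u)}{(z-u)(z-\bar u)}\Big]^{1/2}\Big[\frac2{z-a}+\frac1{a-u}+\frac1{a-\bar u}\Big]$ (square root equal to $1$ at $z=a$); for general $\Omega$, $f_{[\Omega,u]}(a,z)=f_{[\mathbb H,\phi(u)]}(\phi(a),\phi(z))(\phi'(a))^{1/2}(\phi'(z))^{1/2}$ and $f^\dagger_{[\Omega,u]}(a,z)=f_{[\Omega,u]}(a,z)-\frac2{z-a}$; then $\langle T(w)\sigma(u)\rangle^+_\Omega=\langle\sigma(u)\rangle^+_\Omega\cdot\frac14\partial_zf^\dagger_{[\Omega,u]}(w,z)|_{z=w}$. *)

theory Defs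
  imports "HOL-Complex_Analysis.Complex_Analysis" "HOL-Library.Landau_Symbols"
begin

abbreviation uhp :: "complex set" where
  "uhp \<equiv> {z. 0 < Im z}"

definition wirtinger :: "(complex \<Rightarrow> complex) \<Rightarrow> complex \<Rightarrow> complex" where
  "wirtinger g a =
     (vector_derivative (\<lambda>t. g (a + of_real t)) (at 0)
      - \<i> * vector_derivative (\<lambda>t. g (a + \<i> * of_real t)) (at 0)) / 2"

text \<open>
  A domain enters the correlation functions through a conformal map \<open>\<phi>\<close> onto the upper
  half-plane and a holomorphic branch \<open>s\<close> of the square root of its derivative.
\<close>

definition conformal_to_uhp ::
    "complex set \<Rightarrow> (complex \<Rightarrow> complex) \<Rightarrow> (complex \<Rightarrow> complex) \<Rightarrow> bool" where
  "conformal_to_uhp \<Omega> \<phi> s \<longleftrightarrow>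
     \<phi> holomorphic_on \<Omega> \<and> bij_betw \<phi> \<Omega> uhp \<and>
     s holomorphic_on \<Omega> \<and> (\<forall>z\<in>\<Omega>. (s z)\<^sup>2 = deriv \<phi> z)"

definition f_dom ::
    "(complex \<Rightarrow> complex) \<Rightarrow> (complex \<Rightarrow> complex) \<Rightarrow> complex \<Rightarrow> complex \<Rightarrow> complex" where
  "f_dom \<phi> s a z = 2 * s a * s z / (\<phi> z - \<phi> a)"

definition f_star ::
    "(complex \<Rightarrow> complex) \<Rightarrow> (complex \<Rightarrow> complex) \<Rightarrow> complex \<Rightarrow> complex \<Rightarrow> complex" where
  "f_star \<phi> s a z = 2 * cnj (s a) * s z / (\<phi> z - cnj (\<phi> a))"

text \<open>
  The function \<open>z \<mapsto> f a z - 2 / (z - a)\<close> has a removable singularity at \<open>z = a\<close>; its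
  value there is the limit, not the value given by division by zero.
\<close>

definition f_dagger ::
    "(complex \<Rightarrow> complex) \<Rightarrow> (complex \<Rightarrow> complex) \<Rightarrow> complex \<Rightarrow> complex \<Rightarrow> complex" where
  "f_dagger \<phi> s a = remove_sings (\<lambda>z. f_dom \<phi> s a z - 2 / (z - a))"

text \<open>
  The two-valued square root is only used for \<open>z\<close> close to \<open>a\<close>, where the branch equal to
  \<open>1\<close> at \<open>z = a\<close> is the principal one.
\<close>

definition f_uhp_spin :: "complex \<Rightarrow> complex \<Rightarrow> complex \<Rightarrow> complex" where
  "f_uhp_spin u a z =
     csqrt (((a - u) * (a - cnj u)) / ((z - u) * (z - cnj u)))
     * (2 / (z - a) + 1 / (a - u) + 1 / (a - cnj u))"

definition f_spin ::
    "(complex \<Rightarrow> complex) \<Rightarrow> (complex \<Rightarrow> complex) \<Rightarrow> complex \<Rightarrow> complex \<Rightarrow> complex \<Rightarrow> complex" where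
  "f_spin \<phi> s u a z = f_uhp_spin (\<phi> u) (\<phi> a) (\<phi> z) * s a * s z"

definition f_spin_dagger ::
    "(complex \<Rightarrow> complex) \<Rightarrow> (complex \<Rightarrow> complex) \<Rightarrow> complex \<Rightarrow> complex \<Rightarrow> complex \<Rightarrow> complex" where
  "f_spin_dagger \<phi> s u a = remove_sings (\<lambda>z. f_spin \<phi> s u a z - 2 / (z - a))"

definition corr_T ::
    "(complex \<Rightarrow> complex) \<Rightarrow> (complex \<Rightarrow> complex) \<Rightarrow> complex \<Rightarrow> complex" where
  "corr_T \<phi> s w = wirtinger (f_dagger \<phi> s w) w / 4"

definition corr_eps ::
    "(complex \<Rightarrow> complex) \<Rightarrow> (complex \<Rightarrow> complex) \<Rightarrow> complex \<Rightarrow> complex" where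
  "corr_eps \<phi> s a = \<i> / 2 * f_star \<phi> s a a"

definition corr_sigma :: "(complex \<Rightarrow> complex) \<Rightarrow> complex \<Rightarrow> complex" where
  "corr_sigma \<phi> u =
     of_real ((2 * cmod (deriv \<phi> u)) powr (1/8) * Im (\<phi> u) powr (- (1/8)))"

definition corr_TT ::
    "(complex \<Rightarrow> complex) \<Rightarrow> (complex \<Rightarrow> complex) \<Rightarrow> complex \<Rightarrow> complex \<Rightarrow> complex" where
  "corr_TT \<phi> s w w' =
     corr_T \<phi> s w * corr_T \<phi> s w'
     + (wirtinger (\<lambda>x. f_dom \<phi> s x w') w * wirtinger (\<lambda>y. f_dom \<phi> s w y) w'
        - f_dom \<phi> s w w' * wirtinger (\<lambda>x. wirtinger (\<lambda>y. f_dom \<phi> s x y) w') w) / 16"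

definition corr_T_eps ::
    "(complex \<Rightarrow> complex) \<Rightarrow> (complex \<Rightarrow> complex) \<Rightarrow> complex \<Rightarrow> complex \<Rightarrow> complex" where
  "corr_T_eps \<phi> s w a =
     corr_T \<phi> s w * corr_eps \<phi> s a
     + \<i> / 8 * (f_dom \<phi> s a w * wirtinger (\<lambda>x. f_star \<phi> s a x) w
                 - f_star \<phi> s a w * wirtinger (\<lambda>x. f_dom \<phi> s a x) w)"

definition corr_T_sigma ::
    "(complex \<Rightarrow> complex) \<Rightarrow> (complex \<Rightarrow> complex) \<Rightarrow> complex \<Rightarrow> complex \<Rightarrow> complex" where
  "corr_T_sigma \<phi> s w u = corr_sigma \<phi> u * (wirtinger (f_spin_dagger \<phi> s u w) w / 4)"

end

theory Submission
  imports Defs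
begin

text \<open>
  Since \<open>s\<^sup>2 = \<phi>'\<close>, every combination of square roots collapses to one of two rational kernels,
  \<open>G w z = \<phi>'(w) \<phi>'(z) / (\<phi> z - \<phi> w)\<^sup>2\<close> and
  \<open>J a z = \<phi>'(z) (\<phi> a - cnj (\<phi> a)) / ((\<phi> z - \<phi> a) (\<phi> z - cnj (\<phi> a)))\<close>.
  With \<open>h = z - w\<close> and \<open>S\<close> the Schwarzian of \<open>\<phi>\<close>, \<open>G = 1/h\<^sup>2 + S/6 + S' h/12 + O(h\<^sup>2)\<close>, whence
  \<open>\<langle>T\<rangle> = S/24\<close>, while \<open>\<langle>T T\<rangle> = \<langle>T\<rangle> \<langle>T\<rangle> + G\<^sup>2/4\<close>.
  Moreover \<open>\<langle>T \<epsilon>\<rangle> = \<langle>\<epsilon>\<rangle> (\<langle>T\<rangle> + J\<^sup>2/2)\<close> and \<open>\<langle>T \<sigma>\<rangle> = \<langle>\<sigma>\<rangle> (\<langle>T\<rangle> + J\<^sup>2/16)\<close>, where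
  \<open>J = 1/h + L + O(h)\<close> for \<open>h = z - a\<close> and \<open>L\<close> is the logarithmic Wirtinger derivative of \<open>\<langle>\<epsilon>\<rangle>\<close>;
  that of \<open>\<langle>\<sigma>\<rangle>\<close> is \<open>L/8\<close> because \<open>\<langle>\<sigma>\<rangle>\<^sup>8 = 4 \<langle>\<epsilon>\<rangle>\<close>.
\<close>

section \<open>Taylor remainders and the Schwarzian derivative\<close>

text \<open>Near \<open>w\<close> the quotient \<open>R\<close> is the sum of the power series
  shifted by \<open>n\<close>, hence holomorphic; its value \<open>c n\<close> at \<open>w\<close>
  is the constant term of that series. Dividing pointwise makes the identity hold at every
  \<open>z\<close>, so later computations need no radius of convergence.\<close>

lemma holomorphic_taylor_remainder:
  assumes "f holomorphic_on S" "open S" "w \<in> S"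
  obtains R where "isCont R w"
    "\<And>z. f z = (\<Sum>k<n. (deriv ^^ k) f w / fact k * (z - w) ^ k) + R z * (z - w) ^ n"
proof -
  define c where "c k = (deriv ^^ k) f w / fact k" for k
  define R where "R z = (if z = w then c n else (f z - (\<Sum>k<n. c k * (z - w) ^ k)) / (z - w) ^ n)" for z
  obtain r where r: "r > 0" "ball w r \<subseteq> S"
    using assms(2,3) openE by blast
  have sums: "(\<lambda>k. c k * (z - w) ^ k) sums f z" if "z \<in> ball w r" for z
    unfolding c_def
    by (rule holomorphic_power_series[OF holomorphic_on_subset[OF assms(1) r(2)] that])
  have "(\<lambda>k. c (k + n) * (z - w) ^ k) sums R z" if "z \<in> ball w r" for z
  proof (cases "z = w")
    case True
    have "(\<lambda>k. c (k + n) * 0 ^ k) sums c (0 + n)"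
      using powser_sums_zero[of "\<lambda>k. c (k + n)"] by simp
    thus ?thesis using True by (simp add: R_def)
  next
    case False
    have "(\<lambda>k. c (k + n) * (z - w) ^ (k + n)) sums (f z - (\<Sum>k<n. c k * (z - w) ^ k))"
      by (rule sums_split_initial_segment[OF sums[OF that]])
    from sums_divide[OF this, of "(z - w) ^ n"] show ?thesis
      using False by (simp add: R_def power_add)
  qed
  hence "R holomorphic_on ball w r"
    by (rule power_series_holomorphic)
  hence "isCont R w"
    using r(1) by (auto dest!: holomorphic_on_imp_continuous_on simp: continuous_on_eq_continuous_at)
  moreover have "f z = (\<Sum>k<n. c k * (z - w) ^ k) + R z * (z - w) ^ n" for z
    by (cases n) (auto simp: R_def c_def lessThan_Suc_atMost sum.atMost_shift)
  ultimately show ?thesis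
    using that unfolding c_def by blast
qed

definition schwarzian :: "(complex \<Rightarrow> complex) \<Rightarrow> complex \<Rightarrow> complex" where
  "schwarzian f z = (deriv ^^ 3) f z / deriv f z - 3 / 2 * ((deriv ^^ 2) f z / deriv f z)\<^sup>2"

lemma has_field_derivative_higher_deriv:
  assumes "f holomorphic_on S" "open S" "w \<in> S"
  shows "((deriv ^^ n) f has_field_derivative (deriv ^^ Suc n) f w) (at w)"
  using holomorphic_derivI[OF holomorphic_higher_deriv[OF assms(1,2)] assms(2,3)] by simp

lemma has_field_derivative_schwarzian:
  assumes "f holomorphic_on S" "open S" "w \<in> S" "deriv f w \<noteq> 0"
  shows "(schwarzian f has_field_derivative
    (deriv ^^ 4) f w / deriv f w - 4 * (deriv ^^ 2) f w * (deriv ^^ 3) f w / (deriv f w)\<^sup>2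
      + 3 * ((deriv ^^ 2) f w) ^ 3 / (deriv f w) ^ 3) (at w)"
proof -
  note d = has_field_derivative_higher_deriv[OF assms(1-3)]
  have d1: "(deriv f has_field_derivative (deriv ^^ 2) f w) (at w)"
    using d[of 1] by (simp add: numeral_2_eq_2)
  have d2: "((deriv ^^ 2) f has_field_derivative (deriv ^^ 3) f w) (at w)"
    using d[of 2] by (simp add: eval_nat_numeral)
  have d3: "((deriv ^^ 3) f has_field_derivative (deriv ^^ 4) f w) (at w)"
    using d[of 3] by (simp add: eval_nat_numeral)
  show ?thesis
    unfolding schwarzian_def[abs_def]
    by (rule derivative_eq_intros d1 d2 d3 refl assms(4))+
      (use assms(4) in \<open>simp add: divide_simps power2_eq_square power3_eq_cube; algebra\<close>)
qed

text \<open>Pure algebra behind the expansion of G: \<open>p1\<close>, ..., \<open>p4\<close> stand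
  for the Taylor coefficients of f at w, \<open>h * P\<close> for f z - f w and \<open>q\<close> for
  f' z. Here \<open>c1\<close>, \<open>c2\<close>, \<open>c3\<close> are the coefficients of h, h^2,
  h^3 in P^2. The quotient p1 q / P^2 has no term linear in h, since p1 q and P^2 agree up to first
  order. The error is kept explicit so that its continuity can be read off.\<close>

lemma schwarzian_expansion_aux:
  fixes h :: complex
  assumes nz: "p1 \<noteq> 0" "h \<noteq> 0" "P \<noteq> 0"
    and q: "q = p1 + 2 * p2 * h + 3 * p3 * h\<^sup>2 + 4 * p4 * h ^ 3 + R2 * h ^ 4"
    and P: "P = p1 + p2 * h + p3 * h\<^sup>2 + p4 * h ^ 3 + R1 * h ^ 4"
    and m2: "m2 = p3 / p1 - p2\<^sup>2 / p1\<^sup>2"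
    and m3: "m3 = 2 * p4 / p1 - 4 * p2 * p3 / p1\<^sup>2 + 2 * p2 ^ 3 / p1 ^ 3"
  defines "c1 \<equiv> 2 * p1 * p2" and "c2 \<equiv> p2\<^sup>2 + 2 * p1 * p3" and "c3 \<equiv> 2 * p1 * p4 + 2 * p2 * p3"
  shows "p1 * q / (h * P)\<^sup>2 = 1 / h\<^sup>2 + m2 + m3 * h
    + (p1 * R2 - (m2 * c2 + m3 * c1 + (m2 * c3 + m3 * c2) * h + m3 * c3 * h\<^sup>2)
       - (1 + m2 * h\<^sup>2 + m3 * h ^ 3)
         * (p3\<^sup>2 + 2 * p2 * p4 + 2 * p3 * p4 * h + p4\<^sup>2 * h\<^sup>2 + R1 * (2 * P - R1 * h ^ 4))) / P\<^sup>2 * h\<^sup>2"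
    (is "_ = _ + _ + _ + ?E / _ * _")
proof -
  have M2: "p1\<^sup>2 * m2 = p1 * p3 - p2\<^sup>2"
    using nz by (simp add: m2 field_simps power2_eq_square)
  have M3: "p1 * m3 = 2 * p4 - 2 * p2 * m2 - 2 * p2 * p3 / p1"
    using nz by (simp add: m2 m3 field_simps power2_eq_square power3_eq_cube)
  have M3': "p1\<^sup>2 * m3 = 2 * p1 * p4 - 2 * p1 * p2 * m2 - 2 * p2 * p3"
    using nz M3 by (simp add: field_simps power2_eq_square)
  \<comment> \<open>\<open>M2\<close> and \<open>M3'\<close> say exactly that the h^2 and h^3 terms
    of p1 q - (1 + m2 h^2 + m3 h^3) P^2 vanish.\<close>
  have "p1 * q = (1 + m2 * h\<^sup>2 + m3 * h ^ 3) * P\<^sup>2 + ?E * h ^ 4"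
    unfolding q P c1_def c2_def c3_def using M2 M3' by algebra
  hence "p1 * q / (h * P)\<^sup>2 = ((1 + m2 * h\<^sup>2 + m3 * h ^ 3) * P\<^sup>2 + ?E * h ^ 4) / (h * P)\<^sup>2"
    by (rule arg_cong)
  also have "\<dots> = 1 / h\<^sup>2 + m2 + m3 * h + ?E / P\<^sup>2 * h\<^sup>2"
    using nz by (simp add: add_divide_distrib power_mult_distrib eval_nat_numeral)
  finally show ?thesis .
qed

text \<open>Factoring f z - f w = (z - w) P z isolates the double pole; injectivity keeps P z
  nonzero at the other points of S, and P w = f' w is nonzero by assumption.\<close>

lemma schwarzian_expansion:
  assumes "f holomorphic_on S" "open S" "w \<in> S" "deriv f w \<noteq> 0" "inj_on f S"
  obtains R where "isCont R w"
    "\<forall>\<^sub>F z in at w. deriv f w * deriv f z / (f z - f w)\<^sup>2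
       = 1 / (z - w)\<^sup>2 + schwarzian f w / 6 + deriv (schwarzian f) w / 12 * (z - w) + R z * (z - w)\<^sup>2"
proof -
  \<comment> \<open>One order more for f than for f', because a factor z - w is split off f z - f w.
    Both \<open>P\<close> and f' are then known modulo (z - w)^4, which leaves (z - w)^2 after the
    double pole.\<close>
  obtain R1 where R1: "isCont R1 w"
    "\<And>z. f z = (\<Sum>k<5. (deriv ^^ k) f w / fact k * (z - w) ^ k) + R1 z * (z - w) ^ 5"
    by (rule holomorphic_taylor_remainder[OF assms(1-3), where n = 5]) blast
  obtain R2 where R2: "isCont R2 w"
    "\<And>z. deriv f z = (\<Sum>k<4. (deriv ^^ k) (deriv f) w / fact k * (z - w) ^ k) + R2 z * (z - w) ^ 4"
    by (rule holomorphic_taylor_remainder[OF holomorphic_deriv[OF assms(1,2)] assms(2,3), where n = 4]) blast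
  define p1 p2 p3 p4 where "p1 = deriv f w" and "p2 = (deriv ^^ 2) f w / 2"
    and "p3 = (deriv ^^ 3) f w / 6" and "p4 = (deriv ^^ 4) f w / 24"
  define P where "P z = p1 + p2 * (z - w) + p3 * (z - w)\<^sup>2 + p4 * (z - w) ^ 3 + R1 z * (z - w) ^ 4" for z
  have f: "f z - f w = (z - w) * P z" for z
  proof -
    have "(\<Sum>k<5. (deriv ^^ k) f w / fact k * h ^ k) = f w + h * (p1 + p2 * h + p3 * h\<^sup>2 + p4 * h ^ 3)" for h
      unfolding p1_def p2_def p3_def p4_def by (simp add: eval_nat_numeral fact_numeral field_simps)
    hence "f z = f w + (z - w) * (p1 + p2 * (z - w) + p3 * (z - w)\<^sup>2 + p4 * (z - w) ^ 3) + R1 z * (z - w) ^ 5"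
      using R1(2)[of z] by metis
    thus ?thesis
      unfolding P_def by algebra
  qed
  have q: "deriv f z = p1 + 2 * p2 * (z - w) + 3 * p3 * (z - w)\<^sup>2 + 4 * p4 * (z - w) ^ 3 + R2 z * (z - w) ^ 4" for z
    unfolding p1_def p2_def p3_def p4_def
    by (subst R2(2)[of z]) (simp add: eval_nat_numeral fact_numeral)
  define m2 m3 where "m2 = p3 / p1 - p2\<^sup>2 / p1\<^sup>2"
    and "m3 = 2 * p4 / p1 - 4 * p2 * p3 / p1\<^sup>2 + 2 * p2 ^ 3 / p1 ^ 3"
  have m2: "m2 = schwarzian f w / 6"
    by (simp add: m2_def schwarzian_def p1_def p2_def p3_def field_simps power2_eq_square)
  have m3: "m3 = deriv (schwarzian f) w / 12"
    unfolding DERIV_imp_deriv[OF has_field_derivative_schwarzian[OF assms(1-4)]]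
    by (simp add: m3_def p1_def p2_def p3_def p4_def mult_ac power2_eq_square power3_eq_cube)
  define R where "R z = (p1 * R2 z - (m2 * (p2\<^sup>2 + 2 * p1 * p3) + m3 * (2 * p1 * p2)
      + (m2 * (2 * p1 * p4 + 2 * p2 * p3) + m3 * (p2\<^sup>2 + 2 * p1 * p3)) * (z - w)
      + m3 * (2 * p1 * p4 + 2 * p2 * p3) * (z - w)\<^sup>2)
       - (1 + m2 * (z - w)\<^sup>2 + m3 * (z - w) ^ 3)
         * (p3\<^sup>2 + 2 * p2 * p4 + 2 * p3 * p4 * (z - w) + p4\<^sup>2 * (z - w)\<^sup>2
            + R1 z * (2 * P z - R1 z * (z - w) ^ 4))) / (P z)\<^sup>2" for z
  have "isCont P w"
    unfolding P_def[abs_def] by (intro continuous_intros R1)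
  moreover have "P w \<noteq> 0"
    using assms(4) by (simp add: P_def p1_def)
  ultimately have "isCont R w"
    unfolding R_def[abs_def] by (intro continuous_intros R1 R2) auto
  moreover have "\<forall>\<^sub>F z in at w. deriv f w * deriv f z / (f z - f w)\<^sup>2
       = 1 / (z - w)\<^sup>2 + m2 + m3 * (z - w) + R z * (z - w)\<^sup>2"
    using eventually_at_in_open[OF assms(2,3)]
  proof eventually_elim
    case (elim z)
    hence "P z \<noteq> 0"
      using f[of z] assms(3,5) by (auto simp: inj_on_def)
    moreover have "p1 \<noteq> 0" using assms(4) by (simp add: p1_def)
    ultimately show ?case
      unfolding f R_def p1_def[symmetric]
      by (intro schwarzian_expansion_aux q P_def m2_def m3_def) (use elim in auto)
  qed
  ultimately show ?thesis
    using that m2 m3 by simp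
qed

section \<open>Wirtinger derivatives, removable singularities and bounded errors\<close>

text \<open>The directional derivatives along 1 and \<i> are A + B and \<i> (A - B); the combination
  in \<open>wirtinger\<close> cancels B.\<close>

lemma has_derivative_imp_wirtinger:
  assumes "(g has_derivative (\<lambda>h. A * h + B * cnj h)) (at a)"
  shows "wirtinger g a = A"
proof -
  have *: "((\<lambda>t. g (a + c * of_real t)) has_vector_derivative (A * c + B * cnj c)) (at 0)" for c
  proof -
    have "((\<lambda>t::real. a + c * of_real t) has_derivative (\<lambda>t. c * of_real t)) (at 0)"
      by (auto intro!: derivative_eq_intros)
    from has_derivative_compose[OF this, of g "\<lambda>h. A * h + B * cnj h"] assms
    have "((\<lambda>t. g (a + c * of_real t)) has_derivative
        (\<lambda>t. A * (c * of_real t) + B * cnj (c * of_real t))) (at 0)"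
      by simp
    thus ?thesis
      by (simp add: has_vector_derivative_def scaleR_conv_of_real ring_distribs mult_ac)
  qed
  show ?thesis
    using vector_derivative_at[OF *[of 1]] vector_derivative_at[OF *[of \<i>]]
    by (simp add: wirtinger_def right_diff_distrib distrib_left mult.left_commute[of \<i>])
qed

lemma has_field_derivative_imp_wirtinger:
  "(g has_field_derivative D) (at a) \<Longrightarrow> wirtinger g a = D"
  by (rule has_derivative_imp_wirtinger[where B = 0]) (simp add: has_field_derivative_def)

text \<open>
  With \<open>Q = F z * (z - w) / 2\<close>, use \<open>Q - 1 = (Q\<^sup>2 - 1) / (Q + 1)\<close>:
  the square of \<open>Q\<close> no longer contains square roots.
\<close>
lemma wirtinger_remove_sings:
  assumes cont: "\<forall>\<^sub>F z in at w. isCont F z"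
    and lim: "((\<lambda>z. F z * (z - w) / 2) \<longlongrightarrow> 1) (at w)"
    and lim_sq: "((\<lambda>z. ((F z * (z - w) / 2)\<^sup>2 - 1) / (z - w)\<^sup>2) \<longlongrightarrow> c) (at w)"
  shows "wirtinger (remove_sings (\<lambda>z. F z - 2 / (z - w))) w = c"
proof -
  define G where "G z = F z - 2 / (z - w)" for z
  have "((\<lambda>z. 2 * (((F z * (z - w) / 2)\<^sup>2 - 1) / (z - w)\<^sup>2) / (F z * (z - w) / 2 + 1)) \<longlongrightarrow> 2 * c / (1 + 1)) (at w)"
    by (intro tendsto_intros lim lim_sq) auto
  moreover have "\<forall>\<^sub>F z in at w. 2 * (((F z * (z - w) / 2)\<^sup>2 - 1) / (z - w)\<^sup>2) / (F z * (z - w) / 2 + 1) = G z / (z - w)"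
  proof -
    have "\<forall>\<^sub>F z in at w. F z * (z - w) / 2 \<noteq> -1"
      by (rule tendsto_imp_eventually_ne[OF lim]) auto
    thus ?thesis
      using eventually_neq_at_within[of w]
    proof eventually_elim
      case (elim z)
      define Q where "Q = F z * (z - w) / 2"
      have "F z = 2 * Q / (z - w)" and "Q + 1 \<noteq> 0"
        using elim by (auto simp: Q_def add_eq_0_iff2)
      moreover have "Q\<^sup>2 - 1 = (Q - 1) * (Q + 1)"
        by (simp add: power2_eq_square algebra_simps)
      ultimately show ?case
        using elim unfolding Q_def[symmetric] G_def
        by (simp add: diff_divide_distrib[symmetric] power2_eq_square)
    qed
  qed
  ultimately have G: "((\<lambda>z. G z / (z - w)) \<longlongrightarrow> c) (at w)"
    by (simp add: filterlim_cong)
  \<comment> \<open>Convergence of G z / (z - w) forces G to tend to 0. The filled-in value at w is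
    therefore 0, and the quotient is a genuine difference quotient.\<close>
  have "((\<lambda>z. G z / (z - w) * (z - w)) \<longlongrightarrow> c * (w - w)) (at w)"
    by (intro tendsto_intros G)
  moreover have "\<forall>\<^sub>F z in at w. G z / (z - w) * (z - w) = G z"
    using eventually_neq_at_within[of w] by eventually_elim simp
  ultimately have "(G \<longlongrightarrow> 0) (at w)"
    by (simp add: filterlim_cong)
  hence "remove_sings G w = 0"
    by (rule remove_sings_eqI)
  \<comment> \<open>\<open>remove_sings\<close> takes limits at every point, not only at w, so
    agreement with G nearby rests on continuity of F there.\<close>
  moreover have "\<forall>\<^sub>F z in at w. remove_sings G z = G z"
    using cont eventually_neq_at_within[of w]
  proof eventually_elim
    case (elim z)
    hence "isCont G z"
      unfolding G_def[abs_def] by (intro continuous_intros) auto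
    thus ?case
      by (intro remove_sings_eqI) (simp add: isCont_def)
  qed
  hence "\<forall>\<^sub>F z in at w. G z / (z - w) = remove_sings G z / (z - w)"
    by eventually_elim simp
  with G have "((\<lambda>z. remove_sings G z / (z - w)) \<longlongrightarrow> c) (at w)"
    by (simp add: filterlim_cong)
  ultimately have "(remove_sings G has_field_derivative c) (at w)"
    by (simp add: has_field_derivative_iff)
  thus ?thesis
    unfolding G_def[abs_def] by (rule has_field_derivative_imp_wirtinger)
qed

text \<open>Reduces an O(1) claim to a closed formula for the error that is continuous at the point,
  valid on a punctured neighbourhood.\<close>

lemma bigo_1_of_isCont:
  fixes f :: "complex \<Rightarrow> complex"
  assumes "isCont B w" "\<forall>\<^sub>F z in at w. f z = B z"
  shows "f \<in> O[at w](\<lambda>_. 1)"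
proof (rule bigoI_tendsto)
  have "(f \<longlongrightarrow> B w) (at w)"
    using assms by (simp add: isCont_def filterlim_cong)
  thus "((\<lambda>z. f z / 1) \<longlongrightarrow> B w) (at w)"
    by simp
qed auto

section \<open>Conformal maps onto the upper half-plane\<close>

locale uhp_conformal =
  fixes \<Omega> :: "complex set" and \<phi> s :: "complex \<Rightarrow> complex"
  assumes open_domain: "open \<Omega>" and conformal: "conformal_to_uhp \<Omega> \<phi> s"
begin

lemma holomorphic: "\<phi> holomorphic_on \<Omega>" "s holomorphic_on \<Omega>"
  and sqrt_deriv: "z \<in> \<Omega> \<Longrightarrow> deriv \<phi> z = (s z)\<^sup>2"
  and inj: "inj_on \<phi> \<Omega>"
  and Im_pos: "z \<in> \<Omega> \<Longrightarrow> 0 < Im (\<phi> z)"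
  using conformal by (auto simp: conformal_to_uhp_def bij_betw_def)

lemma DERIV_map: "z \<in> \<Omega> \<Longrightarrow> (\<phi> has_field_derivative (s z)\<^sup>2) (at z)"
  using holomorphic_derivI[OF holomorphic(1) open_domain] by (simp add: sqrt_deriv)

lemma DERIV_sqrt: "z \<in> \<Omega> \<Longrightarrow> (s has_field_derivative deriv s z) (at z)"
  using holomorphic_derivI[OF holomorphic(2) open_domain] .

lemma deriv_map_nonzero: "z \<in> \<Omega> \<Longrightarrow> deriv \<phi> z \<noteq> 0"
  using holomorphic_injective_imp_regular[OF holomorphic(1) open_domain inj] .

lemma sqrt_nonzero: "z \<in> \<Omega> \<Longrightarrow> s z \<noteq> 0"
  using deriv_map_nonzero[of z] by (auto simp: sqrt_deriv)

lemma isCont_map: "z \<in> \<Omega> \<Longrightarrow> isCont \<phi> z" and isCont_sqrt: "z \<in> \<Omega> \<Longrightarrow> isCont s z"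
  using DERIV_map DERIV_sqrt DERIV_isCont by blast+

lemma map_eq_iff: "z \<in> \<Omega> \<Longrightarrow> w \<in> \<Omega> \<Longrightarrow> \<phi> z = \<phi> w \<longleftrightarrow> z = w"
  using inj by (auto simp: inj_on_def)

lemma map_neq_cnj: "z \<in> \<Omega> \<Longrightarrow> w \<in> \<Omega> \<Longrightarrow> \<phi> z \<noteq> cnj (\<phi> w)"
  using Im_pos[of z] Im_pos[of w] by (auto simp: complex_eq_iff)

lemma eventually_in_domain: "w \<in> \<Omega> \<Longrightarrow> \<forall>\<^sub>F z in at w. z \<in> \<Omega> - {w}"
  using eventually_at_in_open[OF open_domain] .

section \<open>The kernel G and the one-point function of T\<close>

lemma kernel_expansion:
  assumes "w \<in> \<Omega>"
  obtains R where "isCont R w"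
    "\<forall>\<^sub>F z in at w. deriv \<phi> w * deriv \<phi> z / (\<phi> z - \<phi> w)\<^sup>2
       = 1 / (z - w)\<^sup>2 + schwarzian \<phi> w / 6 + deriv (schwarzian \<phi>) w / 12 * (z - w) + R z * (z - w)\<^sup>2"
  using schwarzian_expansion[OF holomorphic(1) open_domain assms deriv_map_nonzero[OF assms] inj] .

lemma kernel_limit:
  assumes "w \<in> \<Omega>"
  shows "((\<lambda>z. deriv \<phi> w * deriv \<phi> z / (\<phi> z - \<phi> w)\<^sup>2 - 1 / (z - w)\<^sup>2) \<longlongrightarrow> schwarzian \<phi> w / 6) (at w)"
proof -
  obtain R where R: "isCont R w"
    "\<forall>\<^sub>F z in at w. deriv \<phi> w * deriv \<phi> z / (\<phi> z - \<phi> w)\<^sup>2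
       = 1 / (z - w)\<^sup>2 + schwarzian \<phi> w / 6 + deriv (schwarzian \<phi>) w / 12 * (z - w) + R z * (z - w)\<^sup>2"
    using kernel_expansion[OF assms] .
  have "((\<lambda>z. schwarzian \<phi> w / 6 + deriv (schwarzian \<phi>) w / 12 * (z - w) + R z * (z - w)\<^sup>2)
      \<longlongrightarrow> schwarzian \<phi> w / 6 + deriv (schwarzian \<phi>) w / 12 * (w - w) + R w * (w - w)\<^sup>2) (at w)"
    using R(1) by (intro tendsto_intros) (simp add: isCont_def)
  hence "((\<lambda>z. schwarzian \<phi> w / 6 + deriv (schwarzian \<phi>) w / 12 * (z - w) + R z * (z - w)\<^sup>2)
      \<longlongrightarrow> schwarzian \<phi> w / 6) (at w)"
    by simp
  thus ?thesis
    by (rule Lim_transform_eventually) (use R(2) in eventually_elim, simp)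
qed

lemma slope_limit:
  assumes "w \<in> \<Omega>"
  shows "((\<lambda>z. (\<phi> z - \<phi> w) / (z - w)) \<longlongrightarrow> (s w)\<^sup>2) (at w)"
  using DERIV_map[OF assms] by (simp add: has_field_derivative_iff)

text \<open>Squaring \<open>f_dom\<close> loses a sign; this limit recovers it. The quotient is
  \<open>s w * s z\<close> over the slope of \<phi>, and the slope tends to
  \<open>(s w)\<^sup>2\<close>.\<close>

lemma f_dom_limit:
  assumes "w \<in> \<Omega>"
  shows "((\<lambda>z. f_dom \<phi> s w z * (z - w) / 2) \<longlongrightarrow> 1) (at w)"
proof -
  have "((\<lambda>z. s w * s z / ((\<phi> z - \<phi> w) / (z - w))) \<longlongrightarrow> s w * s w / (s w)\<^sup>2) (at w)"
    using isCont_sqrt[OF assms] sqrt_nonzero[OF assms]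
    by (intro tendsto_intros slope_limit assms) (auto simp: isCont_def)
  thus ?thesis
    using sqrt_nonzero[OF assms]
    by (simp add: f_dom_def power2_eq_square mult.assoc del: distrib_right_numeral right_diff_distrib_numeral left_diff_distrib_numeral)
qed

lemma f_dom_square:
  assumes "w \<in> \<Omega>" "z \<in> \<Omega>"
  shows "(f_dom \<phi> s w z * (z - w) / 2)\<^sup>2 = deriv \<phi> w * deriv \<phi> z / (\<phi> z - \<phi> w)\<^sup>2 * (z - w)\<^sup>2"
  using assms by (simp add: f_dom_def sqrt_deriv power_mult_distrib power_divide del: right_diff_distrib_numeral left_diff_distrib_numeral)

lemma isCont_f_dom: "w \<in> \<Omega> \<Longrightarrow> z \<in> \<Omega> - {w} \<Longrightarrow> isCont (f_dom \<phi> s w) z"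
  unfolding f_dom_def[abs_def]
  by (intro continuous_intros isCont_map isCont_sqrt) (auto simp: map_eq_iff)

text \<open>With Q = \<open>f_dom \<phi> s w z * (z - w) / 2\<close>, the quotient (Q^2 - 1) / (z -
  w)^2 is G - 1 / (z - w)^2, whose limit is the constant term S/6 of the expansion.\<close>

lemma corr_T_eq:
  assumes "w \<in> \<Omega>"
  shows "corr_T \<phi> s w = schwarzian \<phi> w / 24"
proof -
  have "wirtinger (f_dagger \<phi> s w) w = schwarzian \<phi> w / 6"
    unfolding f_dagger_def
  proof (rule wirtinger_remove_sings)
    show "\<forall>\<^sub>F z in at w. isCont (f_dom \<phi> s w) z"
      using eventually_in_domain[OF assms] by eventually_elim (rule isCont_f_dom[OF assms])
    show "((\<lambda>z. ((f_dom \<phi> s w z * (z - w) / 2)\<^sup>2 - 1) / (z - w)\<^sup>2) \<longlongrightarrow> schwarzian \<phi> w / 6) (at w)"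
    proof (rule Lim_transform_eventually[OF kernel_limit[OF assms]])
      show "\<forall>\<^sub>F z in at w. deriv \<phi> w * deriv \<phi> z / (\<phi> z - \<phi> w)\<^sup>2 - 1 / (z - w)\<^sup>2
          = ((f_dom \<phi> s w z * (z - w) / 2)\<^sup>2 - 1) / (z - w)\<^sup>2"
        using eventually_in_domain[OF assms]
        by eventually_elim (use assms in \<open>simp add: f_dom_square diff_divide_distrib\<close>)
    qed
  qed (rule f_dom_limit[OF assms])
  thus ?thesis
    by (simp add: corr_T_def del: eq_divide_eq_numeral1 divide_eq_eq_numeral1)
qed

lemma wirtinger_corr_T:
  assumes "w \<in> \<Omega>"
  shows "wirtinger (corr_T \<phi> s) w = deriv (schwarzian \<phi>) w / 24"
proof (rule has_field_derivative_imp_wirtinger)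
  have "((\<lambda>z. schwarzian \<phi> z / 24) has_field_derivative deriv (schwarzian \<phi>) w / 24) (at w)"
    using has_field_derivative_schwarzian[OF holomorphic(1) open_domain assms deriv_map_nonzero[OF assms]]
    by (intro DERIV_cdivide) (simp add: DERIV_imp_deriv)
  thus "(corr_T \<phi> s has_field_derivative deriv (schwarzian \<phi>) w / 24) (at w)"
    by (rule has_field_derivative_transform_within_open[OF _ open_domain assms]) (simp add: corr_T_eq)
qed

lemma isCont_corr_T:
  assumes "w \<in> \<Omega>"
  shows "isCont (corr_T \<phi> s) w"
proof -
  have "isCont (\<lambda>z. schwarzian \<phi> z / 24) w"
    using has_field_derivative_schwarzian[OF holomorphic(1) open_domain assms deriv_map_nonzero[OF assms]]
    by (intro continuous_intros DERIV_isCont) auto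
  moreover have "\<forall>\<^sub>F z in nhds w. corr_T \<phi> s z = schwarzian \<phi> z / 24"
    using eventually_nhds_in_open[OF open_domain assms] by eventually_elim (rule corr_T_eq)
  hence "isCont (corr_T \<phi> s) w \<longleftrightarrow> isCont (\<lambda>z. schwarzian \<phi> z / 24) w"
    by (rule isCont_cong)
  ultimately show ?thesis
    by simp
qed

section \<open>The two-point function of T\<close>

text \<open>The bracket equals -f^2 times the mixed derivative of log f. The factors
  \<open>s w\<close> and \<open>s w'\<close> separate in log f and drop out, so that mixed
  derivative is -G; with f^2 = 4 G the bracket is 4 G^2. The proof verifies this by computing the
  derivatives.\<close>

lemma corr_TT_eq:
  assumes "w \<in> \<Omega>" "w' \<in> \<Omega>" "w \<noteq> w'"
  shows "corr_TT \<phi> s w w' = corr_T \<phi> s w * corr_T \<phi> s w'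
    + (deriv \<phi> w' * deriv \<phi> w / (\<phi> w - \<phi> w')\<^sup>2)\<^sup>2 / 4"
proof -
  define D where "D = \<phi> w' - \<phi> w"
  have nz: "D \<noteq> 0"
    using assms by (auto simp: D_def map_eq_iff)
  have 1: "wirtinger (\<lambda>x. f_dom \<phi> s x w') w = 2 * s w' * (deriv s w / D + s w * (s w)\<^sup>2 / D\<^sup>2)"
  proof (rule has_field_derivative_imp_wirtinger)
    show "((\<lambda>x. f_dom \<phi> s x w') has_field_derivative 2 * s w' * (deriv s w / D + s w * (s w)\<^sup>2 / D\<^sup>2)) (at w)"
      unfolding f_dom_def
      by (rule derivative_eq_intros DERIV_map DERIV_sqrt assms nz[unfolded D_def] refl)+
        (use nz in \<open>simp add: D_def[symmetric] field_simps power2_eq_square\<close>)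
  qed
  \<comment> \<open>The point x stays variable: the outer derivative in \<open>3\<close> needs the
    inner one on a whole neighbourhood of \<open>w\<close>, here the open set
    \<open>\<Omega> - {w'}\<close>.\<close>
  have 2: "wirtinger (\<lambda>y. f_dom \<phi> s x y) w'
      = 2 * s x * (deriv s w' / (\<phi> w' - \<phi> x) - s w' * (s w')\<^sup>2 / (\<phi> w' - \<phi> x)\<^sup>2)"
    if "x \<in> \<Omega> - {w'}" for x
  proof (rule has_field_derivative_imp_wirtinger)
    have nz: "\<phi> w' - \<phi> x \<noteq> 0"
      using that assms by (auto simp: map_eq_iff)
    have "((\<lambda>y. 2 * s x * s y / (\<phi> y - \<phi> x)) has_field_derivative
        (2 * s x * deriv s w' * (\<phi> w' - \<phi> x) - 2 * s x * s w' * (s w')\<^sup>2)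
          / ((\<phi> w' - \<phi> x) * (\<phi> w' - \<phi> x))) (at w')"
      by (rule derivative_eq_intros DERIV_map DERIV_sqrt assms nz refl)+ simp
    also have "(2 * s x * deriv s w' * (\<phi> w' - \<phi> x) - 2 * s x * s w' * (s w')\<^sup>2)
          / ((\<phi> w' - \<phi> x) * (\<phi> w' - \<phi> x))
        = 2 * s x * (deriv s w' / (\<phi> w' - \<phi> x) - s w' * (s w')\<^sup>2 / (\<phi> w' - \<phi> x)\<^sup>2)"
    proof -
      define E where "E = \<phi> w' - \<phi> x"
      show ?thesis
        using nz unfolding E_def[symmetric] by (simp add: field_simps power2_eq_square)
    qed
    finally show "(f_dom \<phi> s x has_field_derivative \<dots>) (at w')"
      by (simp add: f_dom_def[abs_def])
  qed
  have "((\<lambda>x. 2 * s x * (deriv s w' / (\<phi> w' - \<phi> x) - s w' * (s w')\<^sup>2 / (\<phi> w' - \<phi> x)\<^sup>2))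
      has_field_derivative 2 * (deriv s w * (deriv s w' / D - s w' * (s w')\<^sup>2 / D\<^sup>2)
        + s w * (deriv s w' * (s w)\<^sup>2 / D\<^sup>2 - 2 * s w' * (s w')\<^sup>2 * (s w)\<^sup>2 / D ^ 3))) (at w)"
    by (rule derivative_eq_intros DERIV_map DERIV_sqrt assms nz[unfolded D_def] power_not_zero refl)+
      (use nz in \<open>simp add: D_def[symmetric] field_simps eval_nat_numeral\<close>)
  hence "((\<lambda>x. wirtinger (\<lambda>y. f_dom \<phi> s x y) w')
      has_field_derivative 2 * (deriv s w * (deriv s w' / D - s w' * (s w')\<^sup>2 / D\<^sup>2)
        + s w * (deriv s w' * (s w)\<^sup>2 / D\<^sup>2 - 2 * s w' * (s w')\<^sup>2 * (s w)\<^sup>2 / D ^ 3))) (at w)"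
    by (rule has_field_derivative_transform_within_open[where S = "\<Omega> - {w'}"])
      (use assms open_domain in \<open>auto simp: 2\<close>)
  hence 3: "wirtinger (\<lambda>x. wirtinger (\<lambda>y. f_dom \<phi> s x y) w') w =
       2 * (deriv s w * (deriv s w' / D - s w' * (s w')\<^sup>2 / D\<^sup>2)
        + s w * (deriv s w' * (s w)\<^sup>2 / D\<^sup>2 - 2 * s w' * (s w')\<^sup>2 * (s w)\<^sup>2 / D ^ 3))"
    by (rule has_field_derivative_imp_wirtinger)
  have 5: "wirtinger (\<lambda>y. f_dom \<phi> s w y) w' = 2 * s w * (deriv s w' / D - s w' * (s w')\<^sup>2 / D\<^sup>2)"
    using 2[of w] assms by (simp add: D_def)
  have 4: "\<phi> w - \<phi> w' = - D"
    by (simp add: D_def)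
  show ?thesis
    unfolding corr_TT_def 1 3 5
    unfolding 4 f_dom_def D_def[symmetric] sqrt_deriv[OF assms(1)] sqrt_deriv[OF assms(2)]
    using nz by (simp add: field_simps eval_nat_numeral)
qed

text \<open>In terms of T = S/24 the kernel reads G = 1/h^2 + 4 T + 2 T' h + O(h^2) with h = w - w',
  and a quarter of its square has precisely the three stated poles.\<close>

lemma corr_TT_asymptotics:
  assumes "w' \<in> \<Omega>"
  shows "(\<lambda>w. corr_TT \<phi> s w w'
            - (1 / 4 * (1 / (w - w') ^ 4)
               + 2 * corr_T \<phi> s w' / (w - w')\<^sup>2
               + wirtinger (corr_T \<phi> s) w' / (w - w')))
           \<in> O[at w'](\<lambda>_. 1)"
proof -
  define T T' where "T = corr_T \<phi> s w'" and "T' = wirtinger (corr_T \<phi> s) w'"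
  obtain R where R: "isCont R w'"
    "\<forall>\<^sub>F z in at w'. deriv \<phi> w' * deriv \<phi> z / (\<phi> z - \<phi> w')\<^sup>2
       = 1 / (z - w')\<^sup>2 + schwarzian \<phi> w' / 6 + deriv (schwarzian \<phi>) w' / 12 * (z - w') + R z * (z - w')\<^sup>2"
    using kernel_expansion[OF assms] .
  show ?thesis
  proof (rule bigo_1_of_isCont)
    \<comment> \<open>This is the full error: the disconnected product plus what G^2 / 4 retains
      once its poles are removed.\<close>
    show "isCont (\<lambda>z. corr_T \<phi> s z * T + (2 * R z + (4 * T + 2 * T' * (z - w') + R z * (z - w')\<^sup>2)\<^sup>2) / 4) w'"
      by (intro continuous_intros R(1) isCont_corr_T[OF assms]) auto
    show "\<forall>\<^sub>F z in at w'. corr_TT \<phi> s z w'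
            - (1 / 4 * (1 / (z - w') ^ 4) + 2 * corr_T \<phi> s w' / (z - w')\<^sup>2
               + wirtinger (corr_T \<phi> s) w' / (z - w'))
         = corr_T \<phi> s z * T + (2 * R z + (4 * T + 2 * T' * (z - w') + R z * (z - w')\<^sup>2)\<^sup>2) / 4"
      using R(2) eventually_in_domain[OF assms]
    proof eventually_elim
      case (elim z)
      define h where "h = z - w'"
      have h: "h \<noteq> 0"
        using elim by (simp add: h_def)
      have "deriv \<phi> w' * deriv \<phi> z / (\<phi> z - \<phi> w')\<^sup>2 = 1 / h\<^sup>2 + 4 * T + 2 * T' * h + R z * h\<^sup>2"
        using elim(1) by (simp add: T_def T'_def corr_T_eq wirtinger_corr_T assms h_def)
      hence "corr_TT \<phi> s z w' = corr_T \<phi> s z * T + (1 / h\<^sup>2 + (4 * T + 2 * T' * h + R z * h\<^sup>2))\<^sup>2 / 4"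
        using elim(2) assms by (simp add: corr_TT_eq T_def add.assoc)
      also have "\<dots> = corr_T \<phi> s z * T
          + (1 / h ^ 4 + 8 * T / h\<^sup>2 + 4 * T' / h + (2 * R z + (4 * T + 2 * T' * h + R z * h\<^sup>2)\<^sup>2)) / 4"
        using h by (simp add: power2_sum field_simps eval_nat_numeral)
      finally show ?case
        unfolding T_def[symmetric] T'_def[symmetric] h_def[symmetric]
        by (simp add: add_divide_distrib)
    qed
  qed
qed

section \<open>The kernel J shared by energy and spin\<close>

text \<open>This is the logarithmic derivative in z of (\<phi> z - \<phi> a) / (\<phi> z - cnj
  (\<phi> a)), the conformal map of \<Omega> onto the unit disc that sends a to 0.\<close>

definition spin_kernel :: "complex \<Rightarrow> complex \<Rightarrow> complex" where
  "spin_kernel a z = deriv \<phi> z * (\<phi> a - cnj (\<phi> a)) / ((\<phi> z - \<phi> a) * (\<phi> z - cnj (\<phi> a)))"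

text \<open>The Wirtinger derivative of the logarithm of \<open>corr_eps\<close>, with conjugated
  quantities treated as constants and \<phi>' written as the square of \<open>s\<close>.\<close>

definition log_eps_deriv :: "complex \<Rightarrow> complex" where
  "log_eps_deriv a = deriv s a / s a - (s a)\<^sup>2 / (\<phi> a - cnj (\<phi> a))"

text \<open>Partial fractions split J into \<phi>' z / (\<phi> z - \<phi> a), which contributes 1/h
  + s'/s, and the regular part \<open>B\<close>, whose value at \<open>a\<close> is the second term
  of \<open>log_eps_deriv a\<close>.\<close>

lemma spin_kernel_expansion:
  assumes "a \<in> \<Omega>"
  obtains R where "isCont R a"
    "\<forall>\<^sub>F z in at a. spin_kernel a z = 1 / (z - a) + log_eps_deriv a + R z * (z - a)"
proof -
  obtain R1 where R1: "isCont R1 a"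
    "\<And>z. \<phi> z = (\<Sum>k<3. (deriv ^^ k) \<phi> a / fact k * (z - a) ^ k) + R1 z * (z - a) ^ 3"
    by (rule holomorphic_taylor_remainder[OF holomorphic(1) open_domain assms, where n = 3]) blast
  obtain R2 where R2: "isCont R2 a"
    "\<And>z. deriv \<phi> z = (\<Sum>k<2. (deriv ^^ k) (deriv \<phi>) a / fact k * (z - a) ^ k) + R2 z * (z - a)\<^sup>2"
    by (rule holomorphic_taylor_remainder[OF holomorphic_deriv[OF holomorphic(1) open_domain] open_domain assms,
          where n = 2]) blast
  define B where "B z = deriv \<phi> z / (\<phi> z - cnj (\<phi> a))" for z
  have "B holomorphic_on \<Omega>"
    unfolding B_def[abs_def] using map_neq_cnj[OF _ assms]
    by (intro holomorphic_intros holomorphic open_domain) auto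
  then obtain R3 where R3: "isCont R3 a"
    "\<And>z. B z = (\<Sum>k<1. (deriv ^^ k) B a / fact k * (z - a) ^ k) + R3 z * (z - a) ^ 1"
    by (rule holomorphic_taylor_remainder[OF _ open_domain assms, where n = 1]) blast
  \<comment> \<open>These are \<phi>' and \<phi>''/2 at \<open>a\<close>, expressed through
    \<open>s\<close> by differentiating \<phi>' = s^2.\<close>
  define p1 p2 where "p1 = (s a)\<^sup>2" and "p2 = s a * deriv s a"
  have p1: "p1 \<noteq> 0" "deriv \<phi> a = p1" and p2: "p2 / p1 = deriv s a / s a"
    using sqrt_nonzero[OF assms] sqrt_deriv[OF assms] by (simp_all add: p1_def p2_def power2_eq_square)
  have "(deriv \<phi> has_field_derivative 2 * p2) (at a)"
  proof (rule has_field_derivative_transform_within_open[OF _ open_domain assms])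
    show "((\<lambda>z. (s z)\<^sup>2) has_field_derivative 2 * p2) (at a)"
      unfolding p2_def by (auto intro!: derivative_eq_intros DERIV_sqrt assms)
  qed (simp add: sqrt_deriv)
  hence p2': "deriv (deriv \<phi>) a = 2 * p2"
    by (rule DERIV_imp_deriv)
  define P where "P z = p1 + p2 * (z - a) + R1 z * (z - a)\<^sup>2" for z
  have \<phi>: "\<phi> z - \<phi> a = (z - a) * P z" for z
  proof -
    have "\<phi> z = \<phi> a + p1 * (z - a) + p2 * (z - a)\<^sup>2 + R1 z * (z - a) ^ 3"
      by (subst R1(2)[of z]) (simp add: p1 p2' eval_nat_numeral fact_numeral)
    thus ?thesis
      unfolding P_def by algebra
  qed
  have \<phi>': "deriv \<phi> z = p1 + 2 * p2 * (z - a) + R2 z * (z - a)\<^sup>2" for z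
    by (subst R2(2)[of z]) (simp add: p1 p2' eval_nat_numeral fact_numeral)
  \<comment> \<open>Chosen so that \<phi>' z = (1 + p2 / p1 h) P z + E z h^2 with h = z - a;
    dividing by h P z then gives the pole and the constant term.\<close>
  define E where "E z = R2 z - R1 z - p2\<^sup>2 / p1 - p2 / p1 * R1 z * (z - a)" for z
  have "isCont P a"
    unfolding P_def[abs_def] by (intro continuous_intros R1)
  moreover have "P a \<noteq> 0"
    using p1 by (simp add: P_def)
  ultimately have "isCont (\<lambda>z. E z / P z - R3 z) a"
    unfolding E_def by (intro continuous_intros R1 R2 R3 p1) auto
  moreover have "\<forall>\<^sub>F z in at a. spin_kernel a z = 1 / (z - a) + log_eps_deriv a + (E z / P z - R3 z) * (z - a)"
    using eventually_in_domain[OF assms]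
  proof eventually_elim
    case (elim z)
    have h: "z - a \<noteq> 0" and P: "P z \<noteq> 0"
      using elim \<phi>[of z] map_eq_iff[of z a] assms by auto
    have "spin_kernel a z = deriv \<phi> z / (\<phi> z - \<phi> a) - B z"
      using elim map_eq_iff[of z a] map_neq_cnj[of z a] assms
      by (simp add: spin_kernel_def B_def divide_simps) (simp add: algebra_simps)
    also have "deriv \<phi> z = P z + p2 / p1 * ((z - a) * P z) + E z * (z - a)\<^sup>2"
      using p1(1) unfolding \<phi>' P_def E_def by (simp add: field_simps power2_eq_square)
    also have "\<dots> / (\<phi> z - \<phi> a) = 1 / (z - a) + p2 / p1 + E z / P z * (z - a)"
      using h P unfolding \<phi> by (simp add: add_divide_distrib power2_eq_square)
    also have "B z = B a + R3 z * (z - a)"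
      using R3(2)[of z] by simp
    also have "B a = (s a)\<^sup>2 / (\<phi> a - cnj (\<phi> a))"
      by (simp add: B_def p1 p1_def)
    finally show ?case
      unfolding p2 log_eps_deriv_def by (simp add: algebra_simps)
  qed
  ultimately show ?thesis
    by (rule that)
qed

lemma spin_kernel_sq_bigo:
  assumes "a \<in> \<Omega>"
  shows "(\<lambda>z. (spin_kernel a z)\<^sup>2 - (1 / (z - a)\<^sup>2 + 2 * log_eps_deriv a / (z - a))) \<in> O[at a](\<lambda>_. 1)"
proof -
  define L where "L = log_eps_deriv a"
  obtain R where R: "isCont R a"
    "\<forall>\<^sub>F z in at a. spin_kernel a z = 1 / (z - a) + L + R z * (z - a)"
    using spin_kernel_expansion[OF assms] unfolding L_def .
  show ?thesis
  proof (rule bigo_1_of_isCont)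
    show "isCont (\<lambda>z. 2 * R z + (L + R z * (z - a))\<^sup>2) a"
      by (intro continuous_intros R)
    show "\<forall>\<^sub>F z in at a. (spin_kernel a z)\<^sup>2 - (1 / (z - a)\<^sup>2 + 2 * log_eps_deriv a / (z - a))
        = 2 * R z + (L + R z * (z - a))\<^sup>2"
      using R(2) eventually_neq_at_within[of a]
    proof eventually_elim
      case (elim z)
      define h where "h = z - a"
      have "h \<noteq> 0"
        using elim by (simp add: h_def)
      thus ?case
        unfolding elim(1) L_def[symmetric] h_def[symmetric] by (simp add: field_simps power2_eq_square)
    qed
  qed
qed

lemma corr_T_bigo:
  assumes "a \<in> \<Omega>"
  shows "corr_T \<phi> s \<in> O[at a](\<lambda>_. 1)"
  by (rule bigo_1_of_isCont[OF isCont_corr_T[OF assms]]) simp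

section \<open>The energy field\<close>

lemma corr_eps_eq: "corr_eps \<phi> s a = \<i> * (cnj (s a) * s a / (\<phi> a - cnj (\<phi> a)))"
  by (simp add: corr_eps_def f_star_def)

lemma corr_eps_real:
  assumes "a \<in> \<Omega>"
  shows "corr_eps \<phi> s a = of_real (cmod (deriv \<phi> a) / (2 * Im (\<phi> a)))"
proof -
  have "cnj (s a) * s a = of_real (cmod (deriv \<phi> a))"
    using complex_norm_square[of "s a"] by (simp add: sqrt_deriv assms norm_power mult.commute)
  moreover have "\<phi> a - cnj (\<phi> a) = 2 * \<i> * of_real (Im (\<phi> a))"
    by (simp add: complex_eq_iff)
  ultimately show ?thesis
    by (simp add: corr_eps_eq)
qed

text \<open>The antiholomorphic coefficient stays existential, since \<open>wirtinger\<close> reads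
  off only the other one. The full real derivative is stated because the chain rule for
  \<open>corr_sigma\<close> needs it.\<close>

lemma corr_eps_has_derivative:
  assumes "a \<in> \<Omega>"
  obtains B where "(corr_eps \<phi> s has_derivative
    (\<lambda>h. corr_eps \<phi> s a * log_eps_deriv a * h + B * cnj h)) (at a)"
proof -
  have d: "(\<phi> has_derivative (\<lambda>h. (s a)\<^sup>2 * h)) (at a)" "(s has_derivative (\<lambda>h. deriv s a * h)) (at a)"
    using DERIV_map[OF assms] DERIV_sqrt[OF assms] by (simp_all add: has_field_derivative_def)
  define D where "D = \<phi> a - cnj (\<phi> a)"
  have nz: "D \<noteq> 0" "s a \<noteq> 0"
    using map_neq_cnj[OF assms assms] sqrt_nonzero[OF assms] by (simp_all add: D_def)
  have "(corr_eps \<phi> s has_derivative (\<lambda>h. corr_eps \<phi> s a * log_eps_deriv a * h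
      + \<i> * (s a * cnj (deriv s a) / D + cnj (s a) * s a * (cnj (s a))\<^sup>2 / D\<^sup>2) * cnj h)) (at a)"
    unfolding corr_eps_eq[abs_def] log_eps_deriv_def
    by (rule derivative_eq_intros d nz[unfolded D_def] refl)+
      (use nz in \<open>simp add: D_def[symmetric] fun_eq_iff field_simps power2_eq_square\<close>)
  thus ?thesis
    by (rule that)
qed

lemma wirtinger_corr_eps:
  "a \<in> \<Omega> \<Longrightarrow> wirtinger (corr_eps \<phi> s) a = corr_eps \<phi> s a * log_eps_deriv a"
  using corr_eps_has_derivative has_derivative_imp_wirtinger by metis

text \<open>The bracket is f f* times the derivative of log f* - log f. The factor
  \<open>s w\<close> cancels in this difference, whose derivative is J, while f f* = -4 \<i> J times
  \<open>corr_eps \<phi> s a\<close>.\<close>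

lemma corr_T_eps_eq:
  assumes "a \<in> \<Omega>" "w \<in> \<Omega>" "w \<noteq> a"
  shows "corr_T_eps \<phi> s w a = corr_T \<phi> s w * corr_eps \<phi> s a + corr_eps \<phi> s a / 2 * (spin_kernel a w)\<^sup>2"
proof -
  define D E where "D = \<phi> w - \<phi> a" and "E = \<phi> w - cnj (\<phi> a)"
  have nz: "D \<noteq> 0" "E \<noteq> 0" "E - D \<noteq> 0"
    using assms map_eq_iff map_neq_cnj by (auto simp: D_def E_def)
  have d: "((\<lambda>x. 2 * c * s x / (\<phi> x - b)) has_field_derivative
      2 * c * (deriv s w / (\<phi> w - b) - (s w) ^ 3 / (\<phi> w - b)\<^sup>2)) (at w)"
    if nz: "\<phi> w - b \<noteq> 0" for b c
  proof -
    have "((\<lambda>x. 2 * c * s x / (\<phi> x - b)) has_field_derivative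
      (2 * c * deriv s w * (\<phi> w - b) - 2 * c * s w * (s w)\<^sup>2) / ((\<phi> w - b) * (\<phi> w - b))) (at w)"
      by (rule derivative_eq_intros DERIV_map DERIV_sqrt assms nz refl)+ simp
    moreover have "(2 * c * deriv s w * e - 2 * c * s w * (s w)\<^sup>2) / (e * e)
       = 2 * c * (deriv s w / e - (s w) ^ 3 / e\<^sup>2)" if "e \<noteq> 0" for e
      using that by (simp add: field_simps power2_eq_square power3_eq_cube)
    ultimately show ?thesis
      using nz by simp
  qed
  have 1: "wirtinger (\<lambda>x. f_star \<phi> s a x) w = 2 * cnj (s a) * (deriv s w / E - (s w) ^ 3 / E\<^sup>2)"
    unfolding f_star_def E_def
    by (rule has_field_derivative_imp_wirtinger d nz(2)[unfolded E_def])+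
  have 2: "wirtinger (\<lambda>x. f_dom \<phi> s a x) w = 2 * s a * (deriv s w / D - (s w) ^ 3 / D\<^sup>2)"
    unfolding f_dom_def D_def
    by (rule has_field_derivative_imp_wirtinger d nz(1)[unfolded D_def])+
  have 3: "\<phi> a - cnj (\<phi> a) = E - D"
    by (simp add: D_def E_def)
  show ?thesis
    unfolding corr_T_eps_def 1 2 corr_eps_eq spin_kernel_def 3 f_dom_def f_star_def
      D_def[symmetric] E_def[symmetric] sqrt_deriv[OF assms(2)]
    using nz by (simp add: divide_simps eval_nat_numeral) algebra
qed

text \<open>Multiplying the poles 1/h^2 + 2 L/h of J^2 by half of \<open>corr_eps\<close> yields the
  weight 1/2 and, by \<open>wirtinger_corr_eps\<close>, the derivative term.\<close>

lemma corr_T_eps_asymptotics: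
  assumes "a \<in> \<Omega>"
  shows "(\<lambda>w. corr_T_eps \<phi> s w a
            - (1 / 2 * (corr_eps \<phi> s a / (w - a)\<^sup>2)
               + wirtinger (corr_eps \<phi> s) a / (w - a)))
           \<in> O[at a](\<lambda>_. 1)"
proof -
  define e where "e = corr_eps \<phi> s a"
  have "(\<lambda>w. e * corr_T \<phi> s w + e / 2 *
      ((spin_kernel a w)\<^sup>2 - (1 / (w - a)\<^sup>2 + 2 * log_eps_deriv a / (w - a)))) \<in> O[at a](\<lambda>_. 1)"
    by (intro sum_in_bigo landau_o.big.mult_in_1 corr_T_bigo spin_kernel_sq_bigo assms) auto
  also have "?this \<longleftrightarrow> ?thesis"
  proof (rule landau_o.big.in_cong)
    show "\<forall>\<^sub>F w in at a. e * corr_T \<phi> s w + e / 2 *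
          ((spin_kernel a w)\<^sup>2 - (1 / (w - a)\<^sup>2 + 2 * log_eps_deriv a / (w - a)))
        = corr_T_eps \<phi> s w a - (1 / 2 * (corr_eps \<phi> s a / (w - a)\<^sup>2) + wirtinger (corr_eps \<phi> s) a / (w - a))"
      using eventually_in_domain[OF assms]
      by eventually_elim
        (use assms in \<open>simp add: corr_T_eps_eq wirtinger_corr_eps e_def[symmetric] ring_distribs mult_ac\<close>)
  qed
  finally show ?thesis .
qed

section \<open>The spin field\<close>

lemma corr_sigma_eq:
  assumes "a \<in> \<Omega>"
  shows "corr_sigma \<phi> a = of_real ((4 * Re (corr_eps \<phi> s a)) powr (1 / 8))"
  using Im_pos[OF assms]
  by (simp add: corr_sigma_def corr_eps_real[OF assms] powr_divide powr_minus_divide)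

text \<open>Chain rule for t \<mapsto> (4 t)^(1/8), whose logarithmic derivative is 1/(8 t). As the
  power is a real function, the derivative passes through the real part \<open>e\<close> of
  \<open>corr_eps\<close>.\<close>

lemma wirtinger_corr_sigma:
  assumes "a \<in> \<Omega>"
  shows "wirtinger (corr_sigma \<phi>) a = corr_sigma \<phi> a * log_eps_deriv a / 8"
proof -
  define e where "e x = Re (corr_eps \<phi> s x)" for x
  have eps: "corr_eps \<phi> s x = of_real (e x)" if "x \<in> \<Omega>" for x
    by (simp add: e_def corr_eps_real[OF that])
  have pos: "e a > 0"
    using Im_pos[OF assms] deriv_map_nonzero[OF assms] by (simp add: e_def corr_eps_real[OF assms])
  obtain B where "(corr_eps \<phi> s has_derivative
      (\<lambda>h. corr_eps \<phi> s a * log_eps_deriv a * h + B * cnj h)) (at a)"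
    using corr_eps_has_derivative[OF assms] .
  moreover define A where "A = corr_eps \<phi> s a * log_eps_deriv a"
  ultimately have d: "(corr_eps \<phi> s has_derivative (\<lambda>h. A * h + B * cnj h)) (at a)"
    by simp
  have de: "(e has_derivative (\<lambda>h. Re (A * h + B * cnj h))) (at a)"
    unfolding e_def[abs_def] by (rule has_derivative_Re[OF d])
  have "((\<lambda>x. of_real (e x)) has_derivative (\<lambda>h. of_real (Re (A * h + B * cnj h)))) (at a)"
    by (rule has_derivative_of_real[OF de])
  hence "(corr_eps \<phi> s has_derivative (\<lambda>h. of_real (Re (A * h + B * cnj h)))) (at a)"
    by (rule has_derivative_transform_within_open[OF _ open_domain assms]) (simp add: eps)
  hence real: "(\<lambda>h. of_real (Re (A * h + B * cnj h))) = (\<lambda>h. A * h + B * cnj h)"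
    by (rule has_derivative_unique) (rule d)
  define c where "c = (4 * e a) powr (1 / 8) / (8 * e a)"
  have "((\<lambda>t. (4 * t) powr (1 / 8)) has_real_derivative 1 / 8 * (4 * e a) powr (1 / 8 - 1) * 4) (at (e a))"
    using pos by (auto intro!: derivative_eq_intros)
  also have "1 / 8 * (4 * e a) powr (1 / 8 - 1) * 4 = c"
    unfolding c_def powr_diff using pos by simp
  finally have "((\<lambda>x. (4 * e x) powr (1 / 8)) has_derivative (\<lambda>h. c * Re (A * h + B * cnj h))) (at a)"
    using has_derivative_compose[OF de, of "\<lambda>t. (4 * t) powr (1 / 8)" "(*) c"]
    by (simp add: has_field_derivative_def)
  hence "((\<lambda>x. of_real ((4 * e x) powr (1 / 8))) has_derivative
      (\<lambda>h. of_real (c * Re (A * h + B * cnj h)))) (at a)"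
    by (rule has_derivative_of_real)
  also have "(\<lambda>h. of_real (c * Re (A * h + B * cnj h))) = (\<lambda>h. of_real c * A * h + of_real c * B * cnj h)"
    by (simp only: of_real_mult fun_cong[OF real] distrib_left mult.assoc)
  finally have "(corr_sigma \<phi> has_derivative (\<lambda>h. of_real c * A * h + of_real c * B * cnj h)) (at a)"
    by (rule has_derivative_transform_within_open[OF _ open_domain assms]) (simp add: corr_sigma_eq e_def)
  hence "wirtinger (corr_sigma \<phi>) a = of_real c * A"
    by (rule has_derivative_imp_wirtinger)
  also have "\<dots> = corr_sigma \<phi> a * log_eps_deriv a / 8"
    using pos unfolding A_def eps[OF assms] corr_sigma_eq[OF assms] e_def[symmetric] c_def by simp
  finally show ?thesis .
qed

text \<open>With k = q - p, x = p - U and y = p - cnj U, the reason is the identity (2 x y + k (x +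
  y))^2 = 4 x y (x + k) (y + k) + k^2 (x - y)^2. Squaring removes the root and leaves no simple pole
  at q = p.\<close>

lemma f_uhp_spin_square:
  assumes "p \<noteq> U" "p \<noteq> cnj U" "q \<noteq> U" "q \<noteq> cnj U" "q \<noteq> p"
  shows "(f_uhp_spin U p q)\<^sup>2 = 4 / (q - p)\<^sup>2
    + ((U - cnj U) / ((p - U) * (p - cnj U)))\<^sup>2 * (((p - U) * (p - cnj U)) / ((q - U) * (q - cnj U)))"
proof -
  have "(2 / k + 1 / x + 1 / y)\<^sup>2 * (x * y / ((x + k) * (y + k)))
      = 4 / k\<^sup>2 + ((y - x) / (x * y))\<^sup>2 * (x * y / ((x + k) * (y + k)))"
    if "k \<noteq> 0" "x \<noteq> 0" "y \<noteq> 0" "x + k \<noteq> 0" "y + k \<noteq> 0" for k x y :: complex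
    using that by (simp add: divide_simps) algebra
  from this[of "q - p" "p - U" "p - cnj U"] show ?thesis
    using assms by (simp add: f_uhp_spin_def power_mult_distrib mult.commute)
qed

text \<open>The square of \<open>f_spin\<close>, divided by 4, is G plus a term continuous at
  \<open>w\<close>, because \<open>g\<close> tends to 1. That term tends to J^2/4, and G - 1/h^2
  with h = z - w supplies S/6.\<close>

lemma wirtinger_f_spin_dagger:
  assumes "u \<in> \<Omega>" "w \<in> \<Omega>" "w \<noteq> u"
  shows "wirtinger (f_spin_dagger \<phi> s u w) w = schwarzian \<phi> w / 6 + (spin_kernel u w)\<^sup>2 / 4"
proof -
  define U where "U = \<phi> u"
  define g where "g z = (\<phi> w - U) * (\<phi> w - cnj U) / ((\<phi> z - U) * (\<phi> z - cnj U))" for z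
  define A where "A = 1 / (\<phi> w - U) + 1 / (\<phi> w - cnj U)"
  have ne: "\<phi> z \<noteq> U" "\<phi> z \<noteq> cnj U" if "z \<in> \<Omega> - {u}" for z
    using that assms(1) map_eq_iff[of z u] map_neq_cnj[of z u] by (auto simp: U_def)
  have isCont_g: "isCont g z" if "z \<in> \<Omega> - {u}" for z
    unfolding g_def[abs_def] using that ne[OF that]
    by (intro continuous_intros isCont_map) auto
  have w: "w \<in> \<Omega> - {u}"
    using assms by auto
  have g_w: "g w = 1"
    using ne[OF w] by (simp add: g_def)
  have g_lim: "(g \<longlongrightarrow> 1) (at w)"
    using isCont_g[OF w] by (simp add: isCont_def g_w)
  have ev: "\<forall>\<^sub>F z in at w. z \<in> \<Omega> - {u} - {w}"
    by (rule eventually_at_in_open) (use open_domain w in auto)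
  have F: "f_spin \<phi> s u w z = csqrt (g z) * (2 / (\<phi> z - \<phi> w) + A) * s w * s z" for z
    by (simp add: f_spin_def f_uhp_spin_def g_def A_def U_def add.assoc)
  have "wirtinger (remove_sings (\<lambda>z. f_spin \<phi> s u w z - 2 / (z - w))) w
      = schwarzian \<phi> w / 6 + (spin_kernel u w)\<^sup>2 / 4"
  proof (rule wirtinger_remove_sings)
    \<comment> \<open>Close to \<open>w\<close> the values of \<open>g\<close> are close to 1, away
      from the branch cut of \<open>csqrt\<close>.\<close>
    have "\<forall>\<^sub>F z in at w. g z \<in> - \<real>\<^sub>\<le>\<^sub>0"
      by (rule topological_tendstoD[OF g_lim]) (auto simp: closed_nonpos_Reals_complex)
    thus "\<forall>\<^sub>F z in at w. isCont (f_spin \<phi> s u w) z"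
      using ev
    proof eventually_elim
      case (elim z)
      have "\<phi> z \<noteq> \<phi> w"
        using elim(2) assms(2) map_eq_iff[of z w] by auto
      thus ?case
        unfolding F[abs_def] using elim
        by (intro continuous_intros isCont_csqrt' isCont_g isCont_map isCont_sqrt) auto
    qed
  next
    \<comment> \<open>The principal branch gives \<open>csqrt 1 = 1\<close>, which fixes the sign;
      the remaining factor is the one from \<open>f_dom_limit\<close> plus a term that vanishes in
      the limit.\<close>
    have "((\<lambda>z. csqrt (g z)) \<longlongrightarrow> csqrt 1) (at w)"
      by (rule isCont_tendsto_compose[OF _ g_lim]) (auto intro: continuous_at_csqrt)
    moreover have "(\<phi> \<longlongrightarrow> \<phi> w) (at w)" "(s \<longlongrightarrow> s w) (at w)"
      using isCont_map isCont_sqrt assms(2) by (auto simp: isCont_def)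
    ultimately have "((\<lambda>z. csqrt (g z) * (f_dom \<phi> s w z * (z - w) / 2 + A * (s w * s z) * (z - w) / 2))
        \<longlongrightarrow> csqrt 1 * (1 + A * (s w * s w) * (w - w) / 2)) (at w)"
      by (intro tendsto_intros f_dom_limit assms) auto
    thus "((\<lambda>z. f_spin \<phi> s u w z * (z - w) / 2) \<longlongrightarrow> 1) (at w)"
      by (simp add: F f_dom_def ring_distribs add_divide_distrib mult_ac
          del: right_diff_distrib_numeral left_diff_distrib_numeral)
  next
    define K where "K = ((U - cnj U) / ((\<phi> w - U) * (\<phi> w - cnj U)))\<^sup>2"
    have "((\<lambda>z. (deriv \<phi> w * deriv \<phi> z / (\<phi> z - \<phi> w)\<^sup>2 - 1 / (z - w)\<^sup>2) + K * g z * (s w)\<^sup>2 * (s z)\<^sup>2 / 4)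
        \<longlongrightarrow> schwarzian \<phi> w / 6 + K * 1 * (s w)\<^sup>2 * (s w)\<^sup>2 / 4) (at w)"
      using isCont_sqrt[OF assms(2)]
      by (intro tendsto_intros kernel_limit g_lim assms) (auto simp: isCont_def)
    also have "K * 1 * (s w)\<^sup>2 * (s w)\<^sup>2 / 4 = (spin_kernel u w)\<^sup>2 / 4"
      by (simp add: spin_kernel_def K_def U_def sqrt_deriv assms power_divide power_mult_distrib power2_eq_square)
    finally show "((\<lambda>z. ((f_spin \<phi> s u w z * (z - w) / 2)\<^sup>2 - 1) / (z - w)\<^sup>2)
        \<longlongrightarrow> schwarzian \<phi> w / 6 + (spin_kernel u w)\<^sup>2 / 4) (at w)"
    proof (rule Lim_transform_eventually)
      show "\<forall>\<^sub>F z in at w. (deriv \<phi> w * deriv \<phi> z / (\<phi> z - \<phi> w)\<^sup>2 - 1 / (z - w)\<^sup>2) + K * g z * (s w)\<^sup>2 * (s z)\<^sup>2 / 4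
          = ((f_spin \<phi> s u w z * (z - w) / 2)\<^sup>2 - 1) / (z - w)\<^sup>2"
        using ev
      proof eventually_elim
        case (elim z)
        have h: "z - w \<noteq> 0" and k: "\<phi> z \<noteq> \<phi> w"
          using elim assms(2) map_eq_iff[of z w] by auto
        have "(f_uhp_spin U (\<phi> w) (\<phi> z))\<^sup>2 = 4 / (\<phi> z - \<phi> w)\<^sup>2 + K * g z"
          unfolding K_def g_def using ne[of z] ne[OF w] elim k by (intro f_uhp_spin_square) auto
        moreover have "((f * x * y * h / 2)\<^sup>2 - 1) / h\<^sup>2 = f\<^sup>2 * x\<^sup>2 * y\<^sup>2 / 4 - 1 / h\<^sup>2"
          if "h \<noteq> 0" for f x y h :: complex
          using that by (simp add: field_simps power2_eq_square)
        ultimately have "((f_spin \<phi> s u w z * (z - w) / 2)\<^sup>2 - 1) / (z - w)\<^sup>2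
            = (4 / (\<phi> z - \<phi> w)\<^sup>2 + K * g z) * (s w)\<^sup>2 * (s z)\<^sup>2 / 4 - 1 / (z - w)\<^sup>2"
          using h by (simp add: f_spin_def U_def)
        thus ?case
          using elim assms(2) by (simp add: sqrt_deriv ring_distribs add_divide_distrib)
      qed
    qed
  qed
  thus ?thesis
    by (simp add: f_spin_dagger_def)
qed

lemma corr_T_sigma_eq:
  assumes "u \<in> \<Omega>" "w \<in> \<Omega>" "w \<noteq> u"
  shows "corr_T_sigma \<phi> s w u
    = corr_sigma \<phi> u * corr_T \<phi> s w + corr_sigma \<phi> u / 16 * (spin_kernel u w)\<^sup>2"
  using assms by (simp add: corr_T_sigma_def wirtinger_f_spin_dagger corr_T_eq ring_distribs add_divide_distrib)

text \<open>The factor 1/16 in front of J^2 is the weight, and it turns 2 L/h into L/(8 h), matching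
  \<open>wirtinger_corr_sigma\<close>.\<close>

lemma corr_T_sigma_asymptotics:
  assumes "u \<in> \<Omega>"
  shows "(\<lambda>w. corr_T_sigma \<phi> s w u
            - (1 / 16 * (corr_sigma \<phi> u / (w - u)\<^sup>2)
               + wirtinger (corr_sigma \<phi>) u / (w - u)))
           \<in> O[at u](\<lambda>_. 1)"
proof -
  define c where "c = corr_sigma \<phi> u"
  have "(\<lambda>w. c * corr_T \<phi> s w + c / 16 *
      ((spin_kernel u w)\<^sup>2 - (1 / (w - u)\<^sup>2 + 2 * log_eps_deriv u / (w - u)))) \<in> O[at u](\<lambda>_. 1)"
    by (intro sum_in_bigo landau_o.big.mult_in_1 corr_T_bigo spin_kernel_sq_bigo assms) auto
  also have "?this \<longleftrightarrow> ?thesis"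
  proof (rule landau_o.big.in_cong)
    show "\<forall>\<^sub>F w in at u. c * corr_T \<phi> s w + c / 16 *
          ((spin_kernel u w)\<^sup>2 - (1 / (w - u)\<^sup>2 + 2 * log_eps_deriv u / (w - u)))
        = corr_T_sigma \<phi> s w u - (1 / 16 * (corr_sigma \<phi> u / (w - u)\<^sup>2) + wirtinger (corr_sigma \<phi>) u / (w - u))"
      using eventually_in_domain[OF assms]
      by eventually_elim
        (use assms in \<open>simp add: corr_T_sigma_eq wirtinger_corr_sigma c_def[symmetric] ring_distribs mult_ac\<close>)
  qed
  finally show ?thesis .
qed

end


theorem proposition4p18:
  fixes \<Omega> :: "complex set" and \<phi> s :: "complex \<Rightarrow> complex" and w' a u :: complex
  assumes "open \<Omega>" and "simply_connected \<Omega>" and "\<Omega> \<noteq> UNIV"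
    and "conformal_to_uhp \<Omega> \<phi> s"
    and "w' \<in> \<Omega>" and "a \<in> \<Omega>" and "u \<in> \<Omega>"
  shows "(\<lambda>w. corr_TT \<phi> s w w'
            - (1 / 4 * (1 / (w - w') ^ 4)
               + 2 * corr_T \<phi> s w' / (w - w')\<^sup>2
               + wirtinger (corr_T \<phi> s) w' / (w - w')))
           \<in> O[at w'](\<lambda>_. 1) \<and>
         (\<lambda>w. corr_T_eps \<phi> s w a
            - (1 / 2 * (corr_eps \<phi> s a / (w - a)\<^sup>2)
               + wirtinger (corr_eps \<phi> s) a / (w - a)))
           \<in> O[at a](\<lambda>_. 1) \<and>
         (\<lambda>w. corr_T_sigma \<phi> s w u
            - (1 / 16 * (corr_sigma \<phi> u / (w - u)\<^sup>2)
               + wirtinger (corr_sigma \<phi>) u / (w - u)))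
           \<in> O[at u](\<lambda>_. 1)"
proof -
  interpret uhp_conformal \<Omega> \<phi> s
    using assms by unfold_locales
  show ?thesis
    using corr_TT_asymptotics corr_T_eps_asymptotics corr_T_sigma_asymptotics assms by blast
qed

end
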